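(* Let $(B,S)$ be an equilibrium for a finite family of rollups, and let $i\neq j$ be two rollups that both post blobs in it, i.e. $i,j\in S$. Suppose rollups $i$ and $j$ join in posting blobs, and let $B^N$ be the blob price in an equilibrium after joining. Then $$B\ \ge\ B^N\ \ge\ \frac{B}{2}.$$
   Context: Fixed parameters: $a,G,P_1>0$ and a target $k>0$ of blobs per time unit; metadata costs are zero ($P_0=0$). A rollup with transaction arrival rate $R>0$ posting a blob every $t$ time units at blob price $B$ has cost per transaction $\frac{B}{Rt}+\frac{at}{2}$, minimized at $t=\sqrt{2B/(aR)}$ with minimum $\sqrt{2Ba/R}$. Posting directly on the L1 main market instead has optimal cost per transaction $P_1G$. Each rollup uses the strategy with lower optimal cost per transaction (either one in case of a tie). An equilibrium for a finite family of rollups with rates $(R_l)_{l\in I}$, $R_l>0$, is a pair $(B,S)$ where $B>0$ is the blob price and $\emptyset\ne S\subseteq I$ is the set of blob-posting rollups, such that: (i) the blob target is met, $\sum_{l\in S}\sqrt{aR_l/(2B)}=k$, equivalently $B=\frac{a}{2k^2}\bigl(\sum_{l\in S}\sqrt{R_l}\bigr)^2$; (ii) $\sqrt{2Ba/R_l}\le P_1G$ for $l\in S$; (iii) $\sqrt{2Ba/R_l}\ge P_1G$ for $l\in I\setminus S$. When rollups $i$ and $j$ join in posting blobs, they are replaced in the family by a single joint rollup with arrival rate $R_i+R_j$. An equilibrium after joining is an equilibrium $(B^N,S^N)$ for the new family in which the joint rollup belongs to $S^N$ (it posts blobs). *)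

theory Defs
  imports "HOL-Analysis.Analysis"
begin

text \<open>
  Cost per transaction of a rollup with arrival rate R that posts one blob every t time units at
  blob price B. The second summand is the average delay cost.
\<close>
definition blob_cost :: "real \<Rightarrow> real \<Rightarrow> real \<Rightarrow> real \<Rightarrow> real" where
  "blob_cost a R B t = B / (R * t) + a * t / 2"

definition opt_interval :: "real \<Rightarrow> real \<Rightarrow> real \<Rightarrow> real" where
  "opt_interval a R B = sqrt (2 * B / (a * R))"

definition opt_blob_cost :: "real \<Rightarrow> real \<Rightarrow> real \<Rightarrow> real" where
  "opt_blob_cost a R B = sqrt (2 * B * a / R)"

text \<open>
  The number of blobs that a rollup posts per time unit; see \<open>blob_rate_eq\<close> for its relation to
  \<open>opt_interval\<close>.
\<close>
definition blob_rate :: "real \<Rightarrow> real \<Rightarrow> real \<Rightarrow> real" where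
  "blob_rate a R B = sqrt (a * R / (2 * B))"

text \<open>
  The rollups are indexed by I and have arrival rates R. A rollup that is indifferent between
  blobs and the main market (whose cost per transaction is P1 * G) may belong to S or not.
\<close>
definition equilibrium ::
  "real \<Rightarrow> real \<Rightarrow> real \<Rightarrow> real \<Rightarrow> 'i set \<Rightarrow> ('i \<Rightarrow> real) \<Rightarrow> real \<Rightarrow> 'i set \<Rightarrow> bool" where
  "equilibrium a G P1 k I R B S \<longleftrightarrow>
     B > 0 \<and> S \<noteq> {} \<and> S \<subseteq> I \<and>
     (\<Sum>l\<in>S. blob_rate a (R l) B) = k \<and>
     (\<forall>l\<in>S. opt_blob_cost a (R l) B \<le> P1 * G) \<and>
     (\<forall>l\<in>I - S. opt_blob_cost a (R l) B \<ge> P1 * G)"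

text \<open>
  In the family after joining, \<open>None\<close> is the joint rollup and \<open>Some l\<close> is the old rollup l.
\<close>
definition joined_index :: "'i set \<Rightarrow> 'i \<Rightarrow> 'i \<Rightarrow> 'i option set" where
  "joined_index I i j = insert None (Some ` (I - {i, j}))"

definition joined_rate :: "('i \<Rightarrow> real) \<Rightarrow> 'i \<Rightarrow> 'i \<Rightarrow> 'i option \<Rightarrow> real" where
  "joined_rate R i j x = (case x of None \<Rightarrow> R i + R j | Some l \<Rightarrow> R l)"

definition equilibrium_after_joining ::
  "real \<Rightarrow> real \<Rightarrow> real \<Rightarrow> real \<Rightarrow> 'i set \<Rightarrow> ('i \<Rightarrow> real) \<Rightarrow> 'i \<Rightarrow> 'i \<Rightarrow>
   real \<Rightarrow> 'i option set \<Rightarrow> bool" where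
  "equilibrium_after_joining a G P1 k I R i j B S \<longleftrightarrow>
     equilibrium a G P1 k (joined_index I i j) (joined_rate R i j) B S \<and> None \<in> S"

lemma blob_rate_eq:
  assumes "a > 0" "R > 0" "B > 0"
  shows "blob_rate a R B = 1 / opt_interval a R B"
  unfolding blob_rate_def opt_interval_def by (simp add: real_sqrt_divide)

lemma blob_cost_opt_interval:
  assumes "a > 0" "R > 0" "B > 0"
  shows "blob_cost a R B (opt_interval a R B) = opt_blob_cost a R B"
proof -
  define t where "t = opt_interval a R B"
  have t: "t > 0" "t\<^sup>2 = 2 * B / (a * R)"
    using assms by (auto simp: t_def opt_interval_def)
  have eq: "B / (R * t) = a * t / 2"
    using assms t by (simp add: field_simps power2_eq_square)
  hence "blob_cost a R B t = a * t"
    by (simp only: blob_cost_def eq)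
  moreover have "opt_blob_cost a R B = sqrt ((a * t)\<^sup>2)"
    unfolding opt_blob_cost_def power_mult_distrib t(2)
    using assms by (simp add: field_simps power2_eq_square)
  ultimately show ?thesis
    using assms t(1) by (simp add: t_def)
qed

lemma opt_blob_cost_le:
  assumes "a > 0" "R > 0" "B > 0" "t > 0"
  shows "opt_blob_cost a R B \<le> blob_cost a R B t"
proof -
  have "sqrt ((B / (R * t)) * (a * t / 2)) \<le> (B / (R * t) + a * t / 2) / 2"
    using assms by (intro arith_geo_mean_sqrt) auto
  moreover have "(B / (R * t)) * (a * t / 2) = (2 * B * a / R) / 2\<^sup>2"
    using assms by (simp add: field_simps)
  moreover have "sqrt ((2 * B * a / R) / 2\<^sup>2) = opt_blob_cost a R B / 2"
    by (subst real_sqrt_divide) (simp add: opt_blob_cost_def)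
  ultimately have "opt_blob_cost a R B / 2 \<le> blob_cost a R B t / 2"
    by (simp only: blob_cost_def)
  thus ?thesis
    by simp
qed

end

(* Rates are compared at a common price.  Whoever posts blobs in one equilibrium strictly prefers
   blobs at any lower price.  So if B < BN, the old rollups posting after joining also posted
   before, and sqrt (x + y) <= sqrt x + sqrt y shows that the total rate after joining falls below
   k.  If BN < B / 2, all old posters keep posting, and halving the price compensates the loss from
   joining, since sqrt x + sqrt y <= sqrt (2 * (x + y)); the total rate then exceeds k. *)
theory Submission
  imports Defs
begin

lemma blob_rate_nonneg:
  assumes "a > 0" "R > 0" "B > 0"
  shows "0 \<le> blob_rate a R B"
  using assms by (simp add: blob_rate_def)

lemma blob_rate_strict_antimono:
  assumes "a > 0" "R > 0" "B > 0" "B < B'"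
  shows "blob_rate a R B' < blob_rate a R B"
  unfolding blob_rate_def real_sqrt_less_iff
  using assms by (intro divide_strict_left_mono mult_pos_pos) auto

lemma blob_rate_add_le:
  assumes "a > 0" "R > 0" "R' > 0" "B > 0"
  shows "blob_rate a (R + R') B \<le> blob_rate a R B + blob_rate a R' B"
  using assms sqrt_add_le_add_sqrt[of "a * R / (2 * B)" "a * R' / (2 * B)"]
  by (simp add: blob_rate_def distrib_left add_divide_distrib)

text \<open>Halving the price doubles the radicand of the joint rate, and
  \<open>(sqrt x - sqrt y)\<^sup>2 \<ge> 0\<close> shows that a factor 2 suffices. Equality holds
  for \<open>R = R'\<close>, so no smaller discount would do in general.\<close>

lemma blob_rate_half_price_ge:
  assumes "a > 0" "R > 0" "R' > 0" "B > 0"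
  shows "blob_rate a R B + blob_rate a R' B \<le> blob_rate a (R + R') (B / 2)"
proof -
  define x y where "x = a * R / (2 * B)" and "y = a * R' / (2 * B)"
  have nonneg: "x \<ge> 0" "y \<ge> 0"
    using assms by (simp_all add: x_def y_def)
  have "(sqrt x + sqrt y)\<^sup>2 \<le> 2 * (x + y)"
    using nonneg zero_le_power2[of "sqrt x - sqrt y"] by (simp add: power2_sum power2_diff)
  hence "sqrt x + sqrt y \<le> sqrt (2 * (x + y))"
    by (rule real_le_rsqrt)
  moreover have "2 * (x + y) = a * (R + R') / (2 * (B / 2))"
    using assms by (simp add: x_def y_def field_simps)
  ultimately show ?thesis
    by (simp add: blob_rate_def x_def y_def)
qed

lemma opt_blob_cost_strict_mono:
  assumes "a > 0" "R > 0" "B < B'"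
  shows "opt_blob_cost a R B < opt_blob_cost a R B'"
  using assms by (simp add: opt_blob_cost_def divide_strict_right_mono)

text \<open>Cost increases strictly with the price, so a rollup that accepts blobs at
  \<open>B'\<close> strictly prefers them at \<open>B\<close>. Strictness excludes the tie, in which
  an equilibrium may leave the rollup out.\<close>

lemma equilibrium_posts:
  assumes "equilibrium a G P1 k I R B S" "a > 0" "l \<in> I" "R l > 0"
    and "B < B'" "opt_blob_cost a (R l) B' \<le> P1 * G"
  shows "l \<in> S"
proof (rule ccontr)
  assume "l \<notin> S"
  hence "P1 * G \<le> opt_blob_cost a (R l) B"
    using assms(1,3) by (auto simp: equilibrium_def)
  with opt_blob_cost_strict_mono[OF assms(2,4,5)] assms(6) show False
    by linarith
qed

theorem proposition2:
  fixes a G P1 k B BN :: real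
    and I S :: "'i set" and R :: "'i \<Rightarrow> real"
    and i j :: 'i and SN :: "'i option set"
  assumes "a > 0" and "G > 0" and "P1 > 0" and "k > 0"
    and "finite I" and "\<And>l. l \<in> I \<Longrightarrow> R l > 0"
    and "equilibrium a G P1 k I R B S"
    and "i \<in> S" and "j \<in> S" and "i \<noteq> j"
    and "equilibrium_after_joining a G P1 k I R i j BN SN"
  shows "B \<ge> BN \<and> BN \<ge> B / 2"
proof -
  note a = \<open>a > 0\<close> and R = assms(6) and eq = assms(7)
  \<comment> \<open>The old rollups that post after joining, in the original index type, so that
    both equilibria can be compared by sums over subsets of \<open>I\<close>.\<close>
  define T where "T = {l. Some l \<in> SN}"
  have eqN: "equilibrium a G P1 k (joined_index I i j) (joined_rate R i j) BN SN"
    and "None \<in> SN"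
    using assms(11) by (auto simp: equilibrium_after_joining_def)
  have SN: "SN = insert None (Some ` T)"
  proof (rule set_eqI)
    show "x \<in> SN \<longleftrightarrow> x \<in> insert None (Some ` T)" for x
      using \<open>None \<in> SN\<close> by (cases x) (auto simp: T_def)
  qed
  have S: "S \<subseteq> I" and pos: "B > 0" "BN > 0"
    using eq eqN by (auto simp: equilibrium_def)
  have T: "T \<subseteq> I - {i, j}"
    using eqN by (auto simp: equilibrium_def joined_index_def T_def)
  have fin: "finite S" "finite T"
    using S T \<open>finite I\<close> by (auto intro: finite_subset)
  have Rij: "R i > 0" "R j > 0"
    using R S \<open>i \<in> S\<close> \<open>j \<in> S\<close> by auto
  have "S = insert i (insert j (S - {i, j}))"
    using \<open>i \<in> S\<close> \<open>j \<in> S\<close> by auto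
  hence "(\<Sum>l\<in>S. blob_rate a (R l) B) = (\<Sum>l\<in>insert i (insert j (S - {i, j})). blob_rate a (R l) B)"
    by simp
  hence k: "k = blob_rate a (R i) B + blob_rate a (R j) B + (\<Sum>l\<in>S - {i, j}. blob_rate a (R l) B)"
    using eq fin \<open>i \<noteq> j\<close> by (simp add: equilibrium_def)
  have kN: "k = blob_rate a (R i + R j) BN + (\<Sum>l\<in>T. blob_rate a (R l) BN)"
    using eqN fin by (simp add: equilibrium_def SN joined_rate_def sum.reindex image_iff)
  have "\<not> B < BN"
  proof
    assume less: "B < BN"
    have "T \<subseteq> S"
    proof
      fix l assume "l \<in> T"
      hence "opt_blob_cost a (R l) BN \<le> P1 * G"
        using eqN by (auto simp: equilibrium_def SN joined_rate_def)
      thus "l \<in> S"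
        using equilibrium_posts[OF eq a _ _ less] \<open>l \<in> T\<close> T R by blast
    qed
    hence sub: "T \<subseteq> S - {i, j}"
      using T by auto
    have "(\<Sum>l\<in>T. blob_rate a (R l) BN) \<le> (\<Sum>l\<in>T. blob_rate a (R l) B)"
      using T R a pos less
      by (intro sum_mono less_imp_le blob_rate_strict_antimono) auto
    also have "\<dots> \<le> (\<Sum>l\<in>S - {i, j}. blob_rate a (R l) B)"
      using S R a pos fin sub by (intro sum_mono2 blob_rate_nonneg) auto
    \<comment> \<open>The sums over old rollups give only a weak inequality, since \<open>T\<close>
      may be empty. Strictness comes from the joint rollup, whose rate at \<open>BN\<close> is below
      its rate at \<open>B\<close>.\<close>
    finally show False
      using k kN blob_rate_strict_antimono[of a "R i + R j" B BN]
        blob_rate_add_le[of a "R i" "R j" B] a Rij pos less by linarith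
  qed
  moreover have "\<not> BN < B / 2"
  proof
    assume less: "BN < B / 2"
    \<comment> \<open>The old rollups need only this weaker bound; the factor 2 serves the joint
      rollup alone.\<close>
    hence "BN < B"
      using pos by simp
    have sub: "S - {i, j} \<subseteq> T"
    proof
      fix l assume l: "l \<in> S - {i, j}"
      hence "opt_blob_cost a (joined_rate R i j (Some l)) B \<le> P1 * G"
        using eq by (auto simp: equilibrium_def joined_rate_def)
      moreover have "Some l \<in> joined_index I i j" "joined_rate R i j (Some l) > 0"
        using l S R by (auto simp: joined_index_def joined_rate_def)
      ultimately have "Some l \<in> SN"
        using equilibrium_posts[OF eqN a _ _ \<open>BN < B\<close>] by blast
      thus "l \<in> T"
        by (simp add: T_def)
    qed
    have "(\<Sum>l\<in>S - {i, j}. blob_rate a (R l) B) \<le> (\<Sum>l\<in>S - {i, j}. blob_rate a (R l) BN)"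
      using S R a pos \<open>BN < B\<close>
      by (intro sum_mono less_imp_le blob_rate_strict_antimono) auto
    also have "\<dots> \<le> (\<Sum>l\<in>T. blob_rate a (R l) BN)"
      using T R a pos fin sub by (intro sum_mono2 blob_rate_nonneg) auto
    \<comment> \<open>For the joint rollup, the rate at \<open>BN\<close> exceeds that at
      \<open>B / 2\<close>, which already covers the former rates of \<open>i\<close> and
      \<open>j\<close> at \<open>B\<close>. So the total at \<open>BN\<close> would exceed
      \<open>k\<close>.\<close>
    finally show False
      using k kN blob_rate_strict_antimono[of a "R i + R j" BN "B / 2"]
        blob_rate_half_price_ge[of a "R i" "R j" B] a Rij pos less by linarith
  qed
  ultimately show ?thesis
    by simp
qed

end
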